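(* Let $k\le m$, let $\mathbf{M}\in\mathbb{R}^{m\times m}$ be diagonal with positive diagonal entries, let $\mathbf{V}_M\in\mathbb{R}^{m\times k}$ satisfy $\mathbf{V}_M^T\mathbf{M}\mathbf{V}_M=\mathbf{I}_{k}$, and let $\mathbf{A}\in\mathbb{R}^{m\times m}$ be symmetric. Then the eigenvalues of $\mathbf{V}_M^T\mathbf{A}\mathbf{V}_M$ separate the eigenvalues of $\mathbf{M}^{-1}\mathbf{A}$ in the sense that $$\lambda_i\le\tilde\lambda_i\le\lambda_{m-k+i}\qquad\text{for all }1\le i\le k,$$ where $\lambda_i$ is the $i$-th eigenvalue of $\mathbf{M}^{-1}\mathbf{A}$ and $\tilde\lambda_i$ is the $i$-th eigenvalue of $\mathbf{V}_M^T\mathbf{A}\mathbf{V}_M$, in increasing order.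
   Context: Eigenvalues are counted with multiplicity and listed in increasing order. The eigenvalues of $\mathbf{M}^{-1}\mathbf{A}$ are real. *)

theory Defs
  imports
    "Jordan_Normal_Form.Char_Poly"
    "Jordan_Normal_Form.Gauss_Jordan_Elimination"
    "HOL-Library.Multiset"
begin

(* Roots of the characteristic polynomial, each repeated according to its algebraic
   multiplicity.  Only real roots are listed; eigenvalue_list_pencil below shows that
   no eigenvalue is lost for the matrices of interest. *)
definition eigenvalue_list :: "real mat \<Rightarrow> real list" where
  "eigenvalue_list B = sorted_list_of_multiset (proots (char_poly B))"

(* 1-based: meaningful for 1 <= i <= length (eigenvalue_list B). *)
definition ith_eigenvalue :: "real mat \<Rightarrow> nat \<Rightarrow> real" where
  "ith_eigenvalue B i = eigenvalue_list B ! (i - 1)"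

lemma mat_inverse_diagonal:
  fixes M :: "'a :: field mat"
  assumes M: "M \<in> carrier_mat m m" and d: "diagonal_mat M"
    and nz: "\<And>i. i < m \<Longrightarrow> M $$ (i, i) \<noteq> 0"
  shows "mat_inverse M = Some (mat m m (\<lambda>(i, j). if i = j then inverse (M $$ (i, i)) else 0))"
    (is "_ = Some ?D")
proof -
  have D: "?D \<in> carrier_mat m m" by simp
  have MD: "M * ?D = 1\<^sub>m m"
  proof (rule eq_matI)
    fix i j assume ij: "i < dim_row (1\<^sub>m m :: 'a mat)" "j < dim_col (1\<^sub>m m :: 'a mat)"
    then have "(M * ?D) $$ (i, j) = (\<Sum>l<m. M $$ (i, l) * ?D $$ (l, j))"
      using M by (auto simp: scalar_prod_def atLeast0LessThan)
    also have "\<dots> = (\<Sum>l<m. if l = j then M $$ (i, j) * inverse (M $$ (j, j)) else 0)"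
      using ij by (intro sum.cong) auto
    also have "\<dots> = (1\<^sub>m m :: 'a mat) $$ (i, j)"
      using ij d nz M by (auto simp: diagonal_mat_def)
    finally show "(M * ?D) $$ (i, j) = (1\<^sub>m m :: 'a mat) $$ (i, j)" .
  qed (use M in auto)
  then have DM: "?D * M = 1\<^sub>m m"
    using mat_mult_left_right_inverse[OF M D] by simp
  have "M \<in> Units (ring_mat TYPE('a) m undefined)"
    using M D MD DM unfolding Units_def by (force simp: ring_mat_simps)
  then obtain B where B: "mat_inverse M = Some B"
    using mat_inverse(1)[OF M, of undefined] by (meson not_None_eq)
  then have B': "B * M = 1\<^sub>m m" "B \<in> carrier_mat m m"
    using mat_inverse(2)[OF M B] by auto
  have "B = B * (M * ?D)" using MD B' by simp
  also have "\<dots> = (B * M) * ?D" using assoc_mult_mat[OF B'(2) M D] by simp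
  also have "\<dots> = ?D" unfolding B'(1) by (rule left_mult_one_mat[OF D])
  finally show ?thesis using B by simp
qed

lemma char_poly_splits_pencil:
  fixes B :: "real mat" and w :: "nat \<Rightarrow> real"
  assumes B: "B \<in> carrier_mat m m"
    and w: "\<And>i. i < m \<Longrightarrow> w i > 0"
    and sym: "\<And>i j. i < m \<Longrightarrow> j < m \<Longrightarrow> w i * B $$ (i, j) = w j * B $$ (j, i)"
  shows "\<exists>as. length as = m \<and> char_poly B = (\<Prod>a\<leftarrow>as. [:- a, 1:])"
proof -
  interpret poly_hom: map_poly_inj_comm_ring_hom complex_of_real ..
  let ?C = "map_mat complex_of_real B"
  have C: "?C \<in> carrier_mat m m" using B by simp
  have real_root: "z \<in> \<real>" if "poly (char_poly ?C) z = 0" for z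
  proof -
    from that obtain v where v: "v \<in> carrier_vec m" "v \<noteq> 0\<^sub>v m" "?C *\<^sub>v v = z \<cdot>\<^sub>v v"
      using eigenvalue_root_char_poly[OF C] B
      unfolding eigenvalue_def eigenvector_def by auto
    have ev: "(\<Sum>j<m. of_real (B $$ (i, j)) * v $ j) = z * v $ i" if "i < m" for i
    proof -
      have "(?C *\<^sub>v v) $ i = (\<Sum>j<m. of_real (B $$ (i, j)) * v $ j)"
        using that v(1) B by (auto simp: scalar_prod_def atLeast0LessThan)
      then show ?thesis using v that by simp
    qed
    define q where "q = (\<Sum>i<m. \<Sum>j<m. of_real (w i * B $$ (i, j)) * cnj (v $ i) * v $ j)"
    define r where "r = (\<Sum>i<m. w i * (cmod (v $ i))\<^sup>2)"
    have "cnj q = (\<Sum>i<m. \<Sum>j<m. of_real (w i * B $$ (i, j)) * v $ i * cnj (v $ j))"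
      unfolding q_def by simp
    also have "\<dots> = (\<Sum>j<m. \<Sum>i<m. of_real (w i * B $$ (i, j)) * v $ i * cnj (v $ j))"
      by (rule sum.swap)
    also have "\<dots> = q"
      unfolding q_def using sym by (intro sum.cong refl) (simp add: mult_ac)
    finally have qR: "q \<in> \<real>" by (simp add: Reals_cnj_iff)
    have "q = (\<Sum>i<m. of_real (w i) * cnj (v $ i) * (\<Sum>j<m. of_real (B $$ (i, j)) * v $ j))"
      unfolding q_def by (simp add: sum_distrib_left mult_ac)
    also have "\<dots> = (\<Sum>i<m. of_real (w i) * cnj (v $ i) * (z * v $ i))"
      by (intro sum.cong refl) (simp only: ev lessThan_iff)
    also have "\<dots> = (\<Sum>i<m. z * (of_real (w i) * (v $ i * cnj (v $ i))))"
      by (intro sum.cong refl) (simp only: mult_ac)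
    also have "\<dots> = z * of_real r"
      unfolding r_def by (simp add: sum_distrib_left complex_norm_square [symmetric])
    finally have qz: "q = z * of_real r" .
    have "v = 0\<^sub>v m" if "\<forall>i<m. v $ i = 0"
      using that v(1) by (intro eq_vecI) auto
    then obtain i where i: "i < m" "v $ i \<noteq> 0" using v(2) by blast
    have "r > 0" unfolding r_def
      by (rule sum_pos2[of _ i]) (use i w in \<open>auto intro!: mult_nonneg_nonneg simp: less_imp_le\<close>)
    then have "z = q / of_real r" using qz by simp
    then show "z \<in> \<real>" using qR by auto
  qed
  obtain as where as: "char_poly ?C = (\<Prod>a\<leftarrow>as. [:- a, 1:])" "length as = m"
    using char_poly_factorized[OF C] by auto
  have "a \<in> \<real>" if "a \<in> set as" for a
  proof (rule real_root)
    show "poly (char_poly ?C) a = 0"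
      unfolding as(1) poly_prod_list prod_list_zero_iff using that by force
  qed
  then have "map_poly complex_of_real (\<Prod>a\<leftarrow>map Re as. [:- a, 1:]) = (\<Prod>a\<leftarrow>as. [:- a, 1:])"
  proof (induction as)
    case (Cons a as)
    have "complex_of_real (Re a) = a" using Cons.prems by (simp add: of_real_Re)
    moreover have "map_poly complex_of_real [:- Re a, 1:] = [:- of_real (Re a), 1:]"
      by (simp add: map_poly_pCons)
    ultimately show ?case using Cons by (simp add: poly_hom.hom_mult del: mult_pCons_left)
  qed simp
  also have "\<dots> = map_poly complex_of_real (char_poly B)"
    unfolding as(1) [symmetric] by (rule of_real_hom.char_poly_hom[OF B])
  finally have "char_poly B = (\<Prod>a\<leftarrow>map Re as. [:- a, 1:])"
    by (simp only: poly_hom.eq_iff)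
  then show ?thesis using as(2) by (intro exI[of _ "map Re as"]) simp
qed

lemma eigenvalue_list_pencil:
  fixes M A :: "real mat"
  assumes M: "M \<in> carrier_mat m m" "diagonal_mat M" "\<And>i. i < m \<Longrightarrow> M $$ (i, i) > 0"
    and A: "A \<in> carrier_mat m m" "A\<^sup>T = A"
  shows "length (eigenvalue_list (the (mat_inverse M) * A)) = m"
    and "char_poly (the (mat_inverse M) * A)
           = (\<Prod>a\<leftarrow>eigenvalue_list (the (mat_inverse M) * A). [:- a, 1:])"
proof -
  let ?D = "mat m m (\<lambda>(i, j). if i = j then inverse (M $$ (i, i)) else 0)"
  let ?B = "the (mat_inverse M) * A"
  have nz: "M $$ (i, i) \<noteq> 0" if "i < m" for i using M(3)[OF that] by simp
  have Beq: "?B = ?D * A"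
    using mat_inverse_diagonal[OF M(1,2) nz] by simp
  have Bc: "?B \<in> carrier_mat m m" unfolding Beq using A by (auto intro!: mult_carrier_mat)
  have entry: "?B $$ (i, j) = A $$ (i, j) / M $$ (i, i)" if "i < m" "j < m" for i j
  proof -
    have "?B $$ (i, j) = (\<Sum>l<m. ?D $$ (i, l) * A $$ (l, j))"
      unfolding Beq using A that by (auto simp: scalar_prod_def atLeast0LessThan)
    also have "\<dots> = (\<Sum>l<m. if l = i then inverse (M $$ (i, i)) * A $$ (i, j) else 0)"
      using that by (intro sum.cong) auto
    finally show ?thesis using that by (simp add: field_simps)
  qed
  have symA: "A $$ (i, j) = A $$ (j, i)" if "i < m" "j < m" for i j
    using A that by (metis carrier_matD index_transpose_mat(1))
  obtain as where as: "length as = m" "char_poly ?B = (\<Prod>a\<leftarrow>as. [:- a, 1:])"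
    using char_poly_splits_pencil[OF Bc, of "\<lambda>i. M $$ (i, i)"] M(3) nz
    by (auto simp: entry symA)
  have "proots (\<Prod>a\<leftarrow>as. [:- a, 1:]) = mset as" for as :: "real list"
  proof (induction as)
    case (Cons a as)
    have "(\<Prod>a\<leftarrow>as. [:- a, 1:]) \<noteq> 0" by (auto simp: prod_list_zero_iff)
    then have "proots ([:- a, 1:] * (\<Prod>a\<leftarrow>as. [:- a, 1:]))
        = proots [:- a, 1:] + proots (\<Prod>a\<leftarrow>as. [:- a, 1:])"
      by (intro proots_mult) auto
    also have "\<dots> = mset (a # as)"
      unfolding Cons.IH proots_linear_factor by simp
    finally show ?case by (simp only: list.map prod_list.Cons)
  qed simp
  then have ms: "mset (eigenvalue_list ?B) = mset as"
    unfolding eigenvalue_list_def as(2) by simp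
  then show "length (eigenvalue_list ?B) = m"
    using as(1) by (metis size_mset)
  have "(\<Prod>a\<leftarrow>xs. [:- a, 1:]) = (\<Prod>a\<in>#mset xs. [:- a, 1:])" for xs :: "real list"
    by (induction xs) simp_all
  then have "(\<Prod>a\<leftarrow>as. [:- a, 1:]) = (\<Prod>a\<leftarrow>eigenvalue_list ?B. [:- a, 1:])"
    by (simp only: ms)
  then show "char_poly ?B = (\<Prod>a\<leftarrow>eigenvalue_list ?B. [:- a, 1:])"
    using as(2) by simp
qed

(* Taking M to be the identity covers every real symmetric matrix. *)
lemma eigenvalue_list_symmetric:
  fixes A :: "real mat"
  assumes A: "A \<in> carrier_mat n n" "A\<^sup>T = A"
  shows "length (eigenvalue_list A) = n"
    and "char_poly A = (\<Prod>a\<leftarrow>eigenvalue_list A. [:- a, 1:])"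
proof -
  have d: "diagonal_mat (1\<^sub>m n :: real mat)" by (auto simp: diagonal_mat_def)
  have "mat n n (\<lambda>(i, j). if i = j then inverse ((1\<^sub>m n :: real mat) $$ (i, i)) else 0) = 1\<^sub>m n"
    by (intro eq_matI) auto
  then have "the (mat_inverse (1\<^sub>m n :: real mat)) = 1\<^sub>m n"
    using mat_inverse_diagonal[of "1\<^sub>m n :: real mat" n] d by simp
  then have "the (mat_inverse (1\<^sub>m n)) * A = A" using A by simp
  then show "length (eigenvalue_list A) = n"
      and "char_poly A = (\<Prod>a\<leftarrow>eigenvalue_list A. [:- a, 1:])"
    using eigenvalue_list_pencil[of "1\<^sub>m n" n A] d A by auto
qed

end

theory Submission
  imports Defs
begin

text \<open>With \<open>R = sqrt M\<close>, the matrix \<open>M\<^sup>-\<^sup>1 A\<close> is similar to the symmetric matrix \<open>B = R\<^sup>-\<^sup>1 A R\<^sup>-\<^sup>1\<close>, and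
  \<open>U = R V\<close> is an isometry with \<open>U\<^sup>T B U = V\<^sup>T A V\<close>; so it suffices to treat \<open>M = I\<close>. Diagonalizing
  both matrices by orthogonal matrices gives an isometry \<open>G\<close> with \<open>G\<^sup>T diag(\<lambda>) G = diag(\<lambda>')\<close>.
  Each inequality is then the comparison of the two quadratic forms at one nonzero vector \<open>c\<close> for
  which \<open>c\<close> and \<open>G c\<close> vanish on prescribed sets of coordinates; such a \<open>c\<close> exists as soon as fewer
  than \<open>k\<close> coordinates are prescribed in total.\<close>

section \<open>Orthogonal diagonalization of real symmetric matrices\<close>

text \<open>Supplies the orthogonal change of basis that splits off one unit eigenvector in the
  diagonalization below.\<close>

lemma orthogonal_mat_first_col:
  fixes v :: "real vec"
  assumes v: "v \<in> carrier_vec (Suc n)" and norm: "v \<bullet> v = 1"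
  obtains W where "W \<in> carrier_mat (Suc n) (Suc n)" "W\<^sup>T * W = 1\<^sub>m (Suc n)" "col W 0 = v"
proof (cases "v = unit_vec (Suc n) 0")
  case True
  \<comment> \<open>The reflection vector used in the other case would be zero here.\<close>
  then show ?thesis using that[of "1\<^sub>m (Suc n)"] by simp
next
  case False
  \<comment> \<open>\<open>W\<close> is the Householder reflection that exchanges \<open>v\<close> and the first unit vector.\<close>
  define u where "u i = v $ i - (if i = 0 then 1 else 0)" for i
  \<comment> \<open>The squared length of \<open>u\<close>. As \<open>v\<close> has length 1, it
    equals \<open>2 - 2 * v $ 0 = - 2 * u 0\<close>, which is what makes the first column of
    \<open>W\<close> equal to \<open>v\<close>.\<close>
  define s where "s = (\<Sum>l<Suc n. u l * u l)"
  define W where "W = mat (Suc n) (Suc n) (\<lambda>(i, j). (if i = j then 1 else 0) - 2 / s * u i * u j)"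
  have "(\<Sum>l<Suc n. v $ l * v $ l) = 1"
    using v norm by (simp add: scalar_prod_def atLeast0LessThan del: sum.lessThan_Suc)
  moreover have "u l * u l = v $ l * v $ l + (if l = 0 then 1 - 2 * v $ 0 else 0)" for l
    by (simp add: u_def algebra_simps)
  ultimately have s: "s = 2 - 2 * v $ 0"
    unfolding s_def by (simp add: sum.distrib del: sum.lessThan_Suc)
  have "s \<noteq> 0"
  proof
    assume "s = 0"
    then have "\<forall>l<Suc n. u l = 0"
      unfolding s_def by (subst (asm) sum_nonneg_eq_0_iff) auto
    then have "v = unit_vec (Suc n) 0" using v by (intro eq_vecI) (auto simp: u_def)
    with False show False ..
  qed
  have W: "W \<in> carrier_mat (Suc n) (Suc n)" by (simp add: W_def)
  have "W\<^sup>T * W = 1\<^sub>m (Suc n)"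
  proof (rule eq_matI)
    fix i j assume ij: "i < dim_row (1\<^sub>m (Suc n) :: real mat)" "j < dim_col (1\<^sub>m (Suc n) :: real mat)"
    let ?d = "\<lambda>i j. if i = j then 1 else 0 :: real"
    have "(W\<^sup>T * W) $$ (i, j) = (\<Sum>l<Suc n. (?d l i - 2 / s * u l * u i) * (?d l j - 2 / s * u l * u j))"
      using ij by (simp add: W_def scalar_prod_def atLeast0LessThan del: sum.lessThan_Suc)
    \<comment> \<open>The product is sorted so that each Kronecker delta selects one summand and the
      remaining sum is a multiple of \<open>s\<close>; the terms in \<open>u i * u j\<close> then
      cancel.\<close>
    also have "\<dots> = (\<Sum>l<Suc n. (if l = i then ?d i j - 2 / s * u i * u j else 0)
        - (if l = j then 2 / s * u i * u j else 0) + (2 / s)\<^sup>2 * u i * u j * (u l * u l))"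
      by (intro sum.cong refl) (simp add: algebra_simps power2_eq_square)
    also have "\<dots> = ?d i j - 2 / s * u i * u j - 2 / s * u i * u j + (2 / s)\<^sup>2 * u i * u j * s"
      using ij by (simp add: sum.distrib sum_subtractf s_def sum_distrib_left del: sum.lessThan_Suc)
    also have "\<dots> = ?d i j" using \<open>s \<noteq> 0\<close> by (simp add: power2_eq_square field_simps)
    finally show "(W\<^sup>T * W) $$ (i, j) = 1\<^sub>m (Suc n) $$ (i, j)" using ij by simp
  qed (simp_all add: W_def)
  moreover have "col W 0 = v"
  proof (rule eq_vecI)
    fix i assume "i < dim_vec v"
    moreover have "2 / s * u 0 = - 1" using \<open>s \<noteq> 0\<close> by (simp add: u_def s field_simps)
    then have "2 / s * u i * u 0 = - u i" by (metis mult.assoc mult.commute mult_minus1)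
    ultimately show "col W 0 $ i = v $ i" using v by (simp add: W_def u_def)
  qed (use v in \<open>simp add: W_def\<close>)
  ultimately show ?thesis using W that by blast
qed

text \<open>Induction on \<open>es\<close> by deflation: an eigenvector for the head is completed to
  an orthogonal basis, and the tail belongs to the remaining symmetric block. The list is given in
  advance so that the diagonal can be made to appear in any chosen order, in particular the
  increasing one.\<close>

lemma orthogonal_diagonalization:
  fixes A :: "real mat"
  assumes "A \<in> carrier_mat n n" "A\<^sup>T = A" "char_poly A = (\<Prod>e\<leftarrow>es. [:- e, 1:])" "length es = n"
  shows "\<exists>Q \<in> carrier_mat n n. Q\<^sup>T * Q = 1\<^sub>m n \<and> Q\<^sup>T * A * Q = mat_diag n ((!) es)"
  using assms
proof (induction es arbitrary: n A)
  case Nil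
  then show ?case by (intro bexI[of _ "1\<^sub>m 0"] conjI eq_matI) (auto simp: mat_diag_def)
next
  case (Cons e es)
  define k where "k = length es"
  have n: "n = Suc k" using Cons.prems by (simp add: k_def)
  have A: "A \<in> carrier_mat (Suc k) (Suc k)" using Cons.prems n by simp
  have "eigenvalue A e"
    unfolding eigenvalue_root_char_poly[OF A] Cons.prems by simp
  then obtain x where x: "x \<in> carrier_vec (Suc k)" "x \<noteq> 0\<^sub>v (Suc k)" "A *\<^sub>v x = e \<cdot>\<^sub>v x"
    using A unfolding eigenvalue_def eigenvector_def by auto
  define v where "v = (1 / sqrt (x \<bullet> x)) \<cdot>\<^sub>v x"
  have v: "v \<in> carrier_vec (Suc k)" using x by (simp add: v_def)
  have "x \<bullet> x > 0"
    using x conjugate_square_greater_0_vec[OF x(1)] by (simp add: scalar_prod_def conjugate_vec_def)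
  then have "v \<bullet> v = 1" using x(1) by (simp add: v_def)
  then obtain W where W: "W \<in> carrier_mat (Suc k) (Suc k)" "W\<^sup>T * W = 1\<^sub>m (Suc k)" "col W 0 = v"
    using orthogonal_mat_first_col[OF v] by blast
  have WT: "W\<^sup>T \<in> carrier_mat (Suc k) (Suc k)" using W by simp
  have WW: "W * W\<^sup>T = 1\<^sub>m (Suc k)"
    using mat_mult_left_right_inverse[OF WT W(1,2)] .
  define C where "C = W\<^sup>T * A * W"
  have C: "C \<in> carrier_mat (Suc k) (Suc k)" using A W by (simp add: C_def)
  have CT: "C\<^sup>T = C"
    using A W Cons.prems(2) unfolding C_def
    by (simp add: transpose_mult[of _ "Suc k" "Suc k" _ "Suc k"] assoc_mult_mat[of _ "Suc k" "Suc k" _ "Suc k" _ "Suc k"])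
  have Av: "A *\<^sub>v v = e \<cdot>\<^sub>v v"
    using A x by (simp add: v_def mult_mat_vec smult_smult_assoc mult.commute)
  \<comment> \<open>The first column of \<open>C\<close> is \<open>W\<^sup>T\<close> applied to
    \<open>A *\<^sub>v v\<close>, thus \<open>e\<close> times \<open>W\<^sup>T *\<^sub>v v\<close>,
    and the latter is the first column of \<open>W\<^sup>T * W\<close>. Symmetry of \<open>C\<close>
    then also clears its first row.\<close>
  have "col C 0 = e \<cdot>\<^sub>v unit_vec (Suc k) 0"
  proof -
    have "col C 0 = W\<^sup>T *\<^sub>v (A *\<^sub>v col W 0)"
      unfolding C_def assoc_mult_mat[OF WT A W(1)]
      by (simp only: col_mult2[OF WT mult_carrier_mat[OF A W(1)]] col_mult2[OF A W(1)] zero_less_Suc)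
    also have "\<dots> = e \<cdot>\<^sub>v (W\<^sup>T *\<^sub>v col W 0)" using W v Av by (simp add: mult_mat_vec)
    also have "W\<^sup>T *\<^sub>v col W 0 = col (W\<^sup>T * W) 0"
      by (rule col_mult2[OF WT W(1) zero_less_Suc, symmetric])
    finally show ?thesis using W(2) by simp
  qed
  then have C0: "C $$ (i, 0) = (if i = 0 then e else 0)" if "i < Suc k" for i
    using that C by (auto dest!: arg_cong[where f = "\<lambda>v. v $ i"])
  have C0': "C $$ (0, i) = (if i = 0 then e else 0)" if "i < Suc k" for i
    using that C C0[OF that] CT by (metis carrier_matD index_transpose_mat(1) zero_less_Suc)
  define D where "D = mat k k (\<lambda>(i, j). C $$ (Suc i, Suc j))"
  have D: "D \<in> carrier_mat k k" by (simp add: D_def)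
  have block: "C = four_block_mat (mat 1 1 (\<lambda>_. e)) (0\<^sub>m 1 k) (0\<^sub>m k 1) D"
    by (rule eq_matI) (use C C0 C0' in \<open>auto simp: D_def\<close>)
  have "D\<^sup>T = D"
    by (rule eq_matI) (use C CT in \<open>auto simp: D_def, metis Suc_less_eq carrier_matD index_transpose_mat(1)\<close>)
  have "similar_mat C A"
    by (rule similar_matI[of _ _ "W\<^sup>T" W "Suc k"]) (use A W WW C in \<open>auto simp: C_def\<close>)
  \<comment> \<open>Similarity and the block form factor the characteristic polynomial of
    \<open>C\<close> in two ways; cancelling \<open>[:- e, 1:]\<close> leaves that of
    \<open>D\<close>.\<close>
  then have "char_poly C = [:- e, 1:] * (\<Prod>e\<leftarrow>es. [:- e, 1:])"
    using Cons.prems by (simp add: char_poly_similar)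
  moreover have "char_poly C = char_poly (mat 1 1 (\<lambda>_. e)) * char_poly D"
    unfolding block by (rule char_poly_four_block_zeros_col) (use D in auto)
  moreover have "char_poly (mat 1 1 (\<lambda>_. e)) = [:- e, 1:]"
    by (simp add: char_poly_defs det_def sign_def)
  ultimately have "char_poly D = (\<Prod>e\<leftarrow>es. [:- e, 1:])"
    by (metis mult_cancel_left pCons_eq_0_iff zero_neq_one)
  from Cons.IH[OF D \<open>D\<^sup>T = D\<close> this] obtain P where
    P: "P \<in> carrier_mat k k" "P\<^sup>T * P = 1\<^sub>m k" "P\<^sup>T * D * P = mat_diag k ((!) es)"
    by (auto simp: k_def)
  \<comment> \<open>Extends \<open>P\<close> by the identity on the split-off coordinate;
    \<open>W * R\<close> is the orthogonal matrix sought.\<close>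
  define R where "R = four_block_mat (1\<^sub>m 1) (0\<^sub>m 1 k) (0\<^sub>m k 1) P"
  have R: "R \<in> carrier_mat (Suc k) (Suc k)" using four_block_carrier_mat[OF one_carrier_mat[of 1] P(1)] by (simp add: R_def)
  have RT: "R\<^sup>T = four_block_mat (1\<^sub>m 1) (0\<^sub>m 1 k) (0\<^sub>m k 1) P\<^sup>T"
    using P unfolding R_def by (subst transpose_four_block_mat) auto
  have "R\<^sup>T * R = 1\<^sub>m (Suc k)"
    unfolding RT unfolding R_def using P
    by (subst mult_four_block_mat[of _ 1 1 _ k _ k _ _ 1 _ k]) auto
  have "R\<^sup>T * C = four_block_mat (mat 1 1 (\<lambda>_. e)) (0\<^sub>m 1 k) (0\<^sub>m k 1) (P\<^sup>T * D)"
    unfolding RT block using P D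
    by (subst mult_four_block_mat[of _ 1 1 _ k _ k _ _ 1 _ k]) auto
  then have "R\<^sup>T * C * R = four_block_mat (mat 1 1 (\<lambda>_. e)) (0\<^sub>m 1 k) (0\<^sub>m k 1) (mat_diag k ((!) es))"
    unfolding R_def using P D
    by (simp, subst mult_four_block_mat[of _ 1 1 _ k _ k _ _ 1 _ k]) auto
  also have "\<dots> = mat_diag (Suc k) ((!) (e # es))"
    by (rule eq_matI) (auto simp: mat_diag_def nth_Cons')
  finally have RCR: "R\<^sup>T * C * R = mat_diag (Suc k) ((!) (e # es))" .
  note assoc = assoc_mult_mat[of _ "Suc k" "Suc k" _ "Suc k" _ "Suc k"]
  have "(W * R)\<^sup>T * (W * R) = R\<^sup>T * (W\<^sup>T * W) * R"
    using W(1) R by (simp add: transpose_mult[OF W(1) R] assoc)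
  also have "\<dots> = 1\<^sub>m (Suc k)" using R W(2) \<open>R\<^sup>T * R = _\<close> by simp
  finally have "(W * R)\<^sup>T * (W * R) = 1\<^sub>m (Suc k)" .
  moreover have "(W * R)\<^sup>T * A * (W * R) = R\<^sup>T * C * R"
    using W(1) R A by (simp add: transpose_mult[OF W(1) R] C_def assoc)
  ultimately show ?case
    unfolding n using RCR W R by (intro bexI[of _ "W * R"]) auto
qed

section \<open>Vectors with prescribed zero coordinates\<close>

text \<open>Fewer than \<open>k\<close> homogeneous equations in \<open>k\<close> unknowns: padding
  the coefficient rows with zero rows gives a singular square matrix, and \<open>c\<close> is taken
  from its kernel.\<close>

lemma exists_nonzero_orthogonal_vec:
  fixes rs :: "'a :: field vec list"
  assumes len: "length rs < k" and rs: "set rs \<subseteq> carrier_vec k"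
  obtains c where "c \<in> carrier_vec k" "c \<noteq> 0\<^sub>v k" "\<And>r. r \<in> set rs \<Longrightarrow> r \<bullet> c = 0"
proof -
  define N where "N = mat_of_rows k (rs @ replicate (k - length rs) (0\<^sub>v k))"
  have N: "N \<in> carrier_mat k k" using len by (simp add: N_def mat_of_rows_def)
  have row: "row N i = (if i < length rs then rs ! i else 0\<^sub>v k)" if "i < k" for i
    using that len rs unfolding N_def by (subst mat_of_rows_row) (auto simp: nth_append)
  \<comment> \<open>Row \<open>length rs\<close> is the first padding row; exhibiting it as zero
    puts \<open>N\<close> into the shape required by \<open>det_row_0\<close>.\<close>
  have "N = mat\<^sub>r k k (\<lambda>i. if i = length rs then 0\<^sub>v k else row N i)"
  proof (rule eq_rowI)
    fix i assume "i < dim_row (mat\<^sub>r k k (\<lambda>i. if i = length rs then 0\<^sub>v k else row N i))"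
    then have i: "i < k" by simp
    have "row (mat\<^sub>r k k (\<lambda>i. if i = length rs then 0\<^sub>v k else row N i)) i
        = (if i = length rs then 0\<^sub>v k else row N i)"
      by (rule row_mat_of_row_fun) (use N i in auto)
    then show "row N i = row (mat\<^sub>r k k (\<lambda>i. if i = length rs then 0\<^sub>v k else row N i)) i"
      using row[OF i] by simp
  qed (use N in auto)
  also have "det \<dots> = 0" by (rule det_row_0[OF len]) (use N in auto)
  finally have "det N = 0" .
  then obtain c where c: "c \<in> carrier_vec k" "c \<noteq> 0\<^sub>v k" "N *\<^sub>v c = 0\<^sub>v k"
    using det_0_iff_vec_prod_zero_field[OF N] by auto
  have "r \<bullet> c = 0" if r: "r \<in> set rs" for r
  proof -
    obtain i where i: "i < length rs" "r = rs ! i" using r by (metis in_set_conv_nth)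
    then have "r \<bullet> c = (N *\<^sub>v c) $ i" using row[of i] len N by simp
    then show ?thesis using c i len by simp
  qed
  with c that show ?thesis by blast
qed

text \<open>Both sides are the quadratic form of \<open>G\<^sup>T * mat_diag m f * G\<close> at
  \<open>c\<close>, written in coordinates.\<close>

lemma sum_square_isometry:
  fixes G :: "real mat"
  assumes G: "G \<in> carrier_mat m k" and eq: "G\<^sup>T * mat_diag m f * G = mat_diag k g"
    and c: "c \<in> carrier_vec k"
  shows "(\<Sum>j<m. f j * ((G *\<^sub>v c) $ j)\<^sup>2) = (\<Sum>j<k. g j * (c $ j)\<^sup>2)"
proof -
  have diag: "x \<bullet> (mat_diag n h *\<^sub>v x) = (\<Sum>j<n. h j * (x $ j)\<^sup>2)"
    if "x \<in> carrier_vec n" for x :: "real vec" and h n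
  proof -
    have "(mat_diag n h *\<^sub>v x) $ j = h j * x $ j" if "j < n" for j
    proof -
      have "(mat_diag n h *\<^sub>v x) $ j = (\<Sum>l<n. (if j = l then h l else 0) * x $ l)"
        using that \<open>x \<in> carrier_vec n\<close> by (simp add: mat_diag_def scalar_prod_def atLeast0LessThan)
      also have "\<dots> = (\<Sum>l<n. if l = j then h j * x $ j else 0)"
        by (intro sum.cong) auto
      finally show ?thesis using that by simp
    qed
    then show ?thesis using that
      by (simp add: scalar_prod_def atLeast0LessThan mat_diag_def power2_eq_square mult_ac)
  qed
  have Gc: "G *\<^sub>v c \<in> carrier_vec m" using G c by simp
  have DGc: "mat_diag m f *\<^sub>v (G *\<^sub>v c) \<in> carrier_vec m"
    using mat_diag_dim Gc by (rule mult_mat_vec_carrier)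
  have "(\<Sum>j<m. f j * ((G *\<^sub>v c) $ j)\<^sup>2) = (mat_diag m f *\<^sub>v (G *\<^sub>v c)) \<bullet> (G *\<^sub>v c)"
    using diag[OF Gc] comm_scalar_prod[OF DGc Gc] by simp
  also have "\<dots> = (G\<^sup>T *\<^sub>v (mat_diag m f *\<^sub>v (G *\<^sub>v c))) \<bullet> c"
    using transpose_vec_mult_scalar[OF G c DGc] by simp
  also have "\<dots> = (mat_diag k g *\<^sub>v c) \<bullet> c"
    using G c by (simp flip: eq add: assoc_mult_mat_vec[of _ k m _ k]
      assoc_mult_mat_vec[of _ k m _ m] assoc_mult_mat_vec[of _ m m _ k])
  also have "\<dots> = (\<Sum>j<k. g j * (c $ j)\<^sup>2)"
    using diag[OF c] comm_scalar_prod[OF mult_mat_vec_carrier[OF mat_diag_dim c] c] by simp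
  finally show ?thesis .
qed

text \<open>Each index in \<open>I\<close> imposes orthogonality to a row of \<open>G\<close>, each
  index in \<open>J\<close> orthogonality to a unit vector. The cardinality bound leaves a nonzero
  solution \<open>c\<close>, and \<open>d\<close> is its image under \<open>G\<close>.\<close>

lemma isometry_common_vector:
  fixes G :: "real mat"
  assumes G: "G \<in> carrier_mat m k" "G\<^sup>T * G = 1\<^sub>m k"
    and eq: "G\<^sup>T * mat_diag m f * G = mat_diag k g"
    and I: "I \<subseteq> {..<m}" and J: "J \<subseteq> {..<k}" and card: "card I + card J < k"
  obtains c d :: "nat \<Rightarrow> real"
  where "(\<Sum>j<m. f j * (d j)\<^sup>2) = (\<Sum>j<k. g j * (c j)\<^sup>2)"
    and "(\<Sum>j<m. (d j)\<^sup>2) = (\<Sum>j<k. (c j)\<^sup>2)" and "(\<Sum>j<k. (c j)\<^sup>2) > 0"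
    and "\<And>j. j \<in> I \<Longrightarrow> d j = 0" and "\<And>j. j \<in> J \<Longrightarrow> c j = 0"
proof -
  have "finite I" "finite J" using I J finite_subset by blast+
  define rs where "rs = map (row G) (sorted_list_of_set I) @ map (unit_vec k) (sorted_list_of_set J)"
  have rs: "set rs = row G ` I \<union> unit_vec k ` J"
    using \<open>finite I\<close> \<open>finite J\<close> by (simp add: rs_def)
  have "length rs < k" using card by (simp add: rs_def)
  moreover have "set rs \<subseteq> carrier_vec k" using G by (auto simp: rs)
  ultimately obtain c where c: "c \<in> carrier_vec k" "c \<noteq> 0\<^sub>v k" "\<And>r. r \<in> set rs \<Longrightarrow> r \<bullet> c = 0"
    using exists_nonzero_orthogonal_vec by blast
  show thesis
  proof (rule that)
    show "(\<Sum>j<m. f j * ((G *\<^sub>v c) $ j)\<^sup>2) = (\<Sum>j<k. g j * (c $ j)\<^sup>2)"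
      by (rule sum_square_isometry) (use G eq c in auto)
    \<comment> \<open>Preservation of length is the same identity of quadratic forms with all
      weights equal to 1.\<close>
    have "G\<^sup>T * mat_diag m (\<lambda>_. 1) * G = mat_diag k (\<lambda>_. 1)" using G by simp
    from sum_square_isometry[OF G(1) this c(1)]
    show "(\<Sum>j<m. ((G *\<^sub>v c) $ j)\<^sup>2) = (\<Sum>j<k. (c $ j)\<^sup>2)" by simp
    have "\<exists>j<k. c $ j \<noteq> 0"
    proof (rule ccontr)
      assume "\<not> (\<exists>j<k. c $ j \<noteq> 0)"
      then have "c = 0\<^sub>v k" using c by (intro eq_vecI) auto
      with c show False by simp
    qed
    then show "(\<Sum>j<k. (c $ j)\<^sup>2) > 0" by (auto intro!: sum_pos2)
    show "(G *\<^sub>v c) $ j = 0" if "j \<in> I" for j using c(3)[of "row G j"] that I G by (auto simp: rs)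
    show "c $ j = 0" if "j \<in> J" for j using c(1) c(3)[of "unit_vec k j"] that J by (auto simp: rs)
  qed
qed

section \<open>Comparison of diagonal quadratic forms\<close>

text \<open>The bound on \<open>f\<close> is asked for only on the support of \<open>d\<close>, so
  that prescribed zeros of \<open>d\<close> can discard the weights on the wrong side of
  \<open>a\<close>.\<close>

lemma sum_square_ge:
  fixes f d :: "nat \<Rightarrow> real"
  assumes "\<And>j. j < m \<Longrightarrow> d j \<noteq> 0 \<Longrightarrow> a \<le> f j"
  shows "a * (\<Sum>j<m. (d j)\<^sup>2) \<le> (\<Sum>j<m. f j * (d j)\<^sup>2)"
  unfolding sum_distrib_left
proof (rule sum_mono)
  fix j assume "j \<in> {..<m}"
  then show "a * (d j)\<^sup>2 \<le> f j * (d j)\<^sup>2"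
    using assms[of j] by (cases "d j = 0") (auto intro: mult_right_mono)
qed

lemma sum_square_le:
  fixes f d :: "nat \<Rightarrow> real"
  assumes "\<And>j. j < m \<Longrightarrow> d j \<noteq> 0 \<Longrightarrow> f j \<le> a"
  shows "(\<Sum>j<m. f j * (d j)\<^sup>2) \<le> a * (\<Sum>j<m. (d j)\<^sup>2)"
  using sum_square_ge[of m d "- a" "\<lambda>j. - f j"] assms by (simp add: sum_negf)

lemma isometry_interlacing:
  fixes G :: "real mat" and f g :: "nat \<Rightarrow> real"
  assumes G: "G \<in> carrier_mat m k" "G\<^sup>T * G = 1\<^sub>m k"
    and eq: "G\<^sup>T * mat_diag m f * G = mat_diag k g"
    and f: "\<And>i j. i \<le> j \<Longrightarrow> j < m \<Longrightarrow> f i \<le> f j"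
    and g: "\<And>i j. i \<le> j \<Longrightarrow> j < k \<Longrightarrow> g i \<le> g j"
    and km: "k \<le> m" and i: "i < k"
  shows "f i \<le> g i" "g i \<le> f (m - k + i)"
proof -
  \<comment> \<open>For the lower bound \<open>d\<close> lives on indices \<open>\<ge> i\<close> and
    \<open>c\<close> on indices \<open>\<le> i\<close>, which costs
    \<open>i + (k - 1 - i) = k - 1\<close> conditions.\<close>
  have card: "card {..<i} + card {Suc i..<k} < k" using i by simp
  have sub: "{..<i} \<subseteq> {..<m}" "{Suc i..<k} \<subseteq> {..<k}" using i km by auto
  obtain c d :: "nat \<Rightarrow> real" where
    cd: "(\<Sum>j<m. f j * (d j)\<^sup>2) = (\<Sum>j<k. g j * (c j)\<^sup>2)"
      "(\<Sum>j<m. (d j)\<^sup>2) = (\<Sum>j<k. (c j)\<^sup>2)" "(\<Sum>j<k. (c j)\<^sup>2) > 0"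
      and d: "\<And>j. j \<in> {..<i} \<Longrightarrow> d j = 0" and c: "\<And>j. j \<in> {Suc i..<k} \<Longrightarrow> c j = 0"
    by (rule isometry_common_vector[OF G eq sub card], rule that)
  have "f i * (\<Sum>j<m. (d j)\<^sup>2) \<le> (\<Sum>j<m. f j * (d j)\<^sup>2)"
    by (rule sum_square_ge) (meson d f lessThan_iff not_less)
  also have "\<dots> \<le> g i * (\<Sum>j<k. (c j)\<^sup>2)"
    unfolding cd(1) by (rule sum_square_le) (use c g i in \<open>auto simp: not_less_eq_eq[symmetric]\<close>)
  finally show "f i \<le> g i" using cd by simp
next
  \<comment> \<open>The mirror image: \<open>d\<close> lives on indices
    \<open>\<le> m - k + i\<close> and \<open>c\<close> on indices \<open>\<ge> i\<close>. The
    number of conditions is again \<open>(k - 1 - i) + i = k - 1\<close>, which is where the shift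
    \<open>m - k\<close> comes from.\<close>
  have card: "card {Suc (m - k + i)..<m} + card {..<i} < k" using i km by simp
  have sub: "{Suc (m - k + i)..<m} \<subseteq> {..<m}" "{..<i} \<subseteq> {..<k}" using i km by auto
  obtain c d :: "nat \<Rightarrow> real" where
    cd: "(\<Sum>j<m. f j * (d j)\<^sup>2) = (\<Sum>j<k. g j * (c j)\<^sup>2)"
      "(\<Sum>j<m. (d j)\<^sup>2) = (\<Sum>j<k. (c j)\<^sup>2)" "(\<Sum>j<k. (c j)\<^sup>2) > 0"
      and d: "\<And>j. j \<in> {Suc (m - k + i)..<m} \<Longrightarrow> d j = 0" and c: "\<And>j. j \<in> {..<i} \<Longrightarrow> c j = 0"
    by (rule isometry_common_vector[OF G eq sub card], rule that)
  have "g i * (\<Sum>j<k. (c j)\<^sup>2) \<le> (\<Sum>j<k. g j * (c j)\<^sup>2)"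
    by (rule sum_square_ge) (meson c g lessThan_iff not_less)
  also have "\<dots> \<le> f (m - k + i) * (\<Sum>j<m. (d j)\<^sup>2)"
    unfolding cd(1)[symmetric]
  proof (rule sum_square_le)
    fix j assume "j < m" "d j \<noteq> 0"
    then have "j \<le> m - k + i" using d[of j] by (cases "j \<le> m - k + i") auto
    then show "f j \<le> f (m - k + i)" using i km by (intro f) auto
  qed
  finally show "g i \<le> f (m - k + i)" using cd by simp
qed

section \<open>Interlacing for compressions of symmetric matrices\<close>

lemma eigenvalue_list_interlacing:
  fixes A V :: "real mat"
  assumes A: "A \<in> carrier_mat m m" "A\<^sup>T = A"
    and V: "V \<in> carrier_mat m k" "V\<^sup>T * V = 1\<^sub>m k" and km: "k \<le> m" and i: "i < k"
  shows "eigenvalue_list A ! i \<le> eigenvalue_list (V\<^sup>T * A * V) ! i"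
    and "eigenvalue_list (V\<^sup>T * A * V) ! i \<le> eigenvalue_list A ! (m - k + i)"
proof -
  let ?B = "V\<^sup>T * A * V"
  have B: "?B \<in> carrier_mat k k" using A V by simp
  have BT: "?B\<^sup>T = ?B"
    using A V by (simp add: transpose_mult[of _ k m _ k] transpose_mult[of _ m m _ k]
      assoc_mult_mat[of _ k m _ m _ k])
  obtain Q where Q: "Q \<in> carrier_mat m m" "Q\<^sup>T * Q = 1\<^sub>m m"
    "Q\<^sup>T * A * Q = mat_diag m ((!) (eigenvalue_list A))"
    using orthogonal_diagonalization[OF A] eigenvalue_list_symmetric[OF A] by blast
  obtain P where P: "P \<in> carrier_mat k k" "P\<^sup>T * P = 1\<^sub>m k"
    "P\<^sup>T * ?B * P = mat_diag k ((!) (eigenvalue_list ?B))"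
    using orthogonal_diagonalization[OF B BT] eigenvalue_list_symmetric[OF B BT] by blast
  have QT: "Q\<^sup>T \<in> carrier_mat m m" using Q by simp
  have QQ: "Q * Q\<^sup>T = 1\<^sub>m m" using mat_mult_left_right_inverse[OF QT Q(1,2)] .
  define W where "W = V * P"
  have W: "W \<in> carrier_mat m k" using V P by (simp add: W_def)
  have WT: "W\<^sup>T = P\<^sup>T * V\<^sup>T" unfolding W_def by (rule transpose_mult[OF V(1) P(1)])
  have QX: "Q * (Q\<^sup>T * X) = X" if "X \<in> carrier_mat m k" for X
    using assoc_mult_mat[OF Q(1) QT that] QQ that by simp
  \<comment> \<open>The isometry \<open>V\<close> expressed in the two eigenbases, \<open>P\<close>
    on the source and \<open>Q\<close> on the target.\<close>
  define G where "G = Q\<^sup>T * W"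
  have G: "G \<in> carrier_mat m k" using Q W by (simp add: G_def)
  have GT: "G\<^sup>T = W\<^sup>T * Q" unfolding G_def using transpose_mult[OF QT W] by simp
  have "G\<^sup>T * G = W\<^sup>T * W"
    using Q(1) W QX unfolding GT unfolding G_def by (simp add: assoc_mult_mat[of _ k m _ m _ k])
  also have "\<dots> = P\<^sup>T * (V\<^sup>T * V) * P"
    using P(1) V(1) unfolding WT unfolding W_def
    by (simp add: assoc_mult_mat[of _ k k _ m _ k] assoc_mult_mat[of _ k m _ k _ k] assoc_mult_mat[of _ k k _ k _ k])
  also have "\<dots> = 1\<^sub>m k" using P V by simp
  finally have 1: "G\<^sup>T * G = 1\<^sub>m k" .
  have "G\<^sup>T * (Q\<^sup>T * A * Q) * G = W\<^sup>T * A * W"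
    using Q(1) W QX A(1) unfolding GT unfolding G_def by (simp add: assoc_mult_mat[of _ k m _ m _ k]
      assoc_mult_mat[of _ k m _ m _ m] assoc_mult_mat[of _ m m _ m _ k] assoc_mult_mat[of _ m m _ m _ m])
  also have "\<dots> = P\<^sup>T * ?B * P"
    using A V(1) P(1) unfolding WT unfolding W_def
    by (simp add: assoc_mult_mat[of _ k k _ m _ k] assoc_mult_mat[of _ k k _ m _ m] assoc_mult_mat[of _ k m _ m _ k]
      assoc_mult_mat[of _ k m _ k _ k] assoc_mult_mat[of _ m m _ k _ k] assoc_mult_mat[of _ k k _ k _ k])
  finally have 2: "G\<^sup>T * mat_diag m ((!) (eigenvalue_list A)) * G = mat_diag k ((!) (eigenvalue_list ?B))"
    unfolding Q P .
  have sorted: "sorted (eigenvalue_list X)" for X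
    by (simp add: eigenvalue_list_def sorted_sorted_list_of_multiset)
  note interlacing = isometry_interlacing[OF G 1 2 _ _ km i]
  show "eigenvalue_list A ! i \<le> eigenvalue_list ?B ! i"
    and "eigenvalue_list ?B ! i \<le> eigenvalue_list A ! (m - k + i)"
    by (rule interlacing; use sorted eigenvalue_list_symmetric(1)[OF A] eigenvalue_list_symmetric(1)[OF B BT]
        in \<open>auto intro: sorted_nth_mono\<close>)+
qed

section \<open>Reduction of the weighted problem to the symmetric one\<close>

theorem mainTheorem2:
  fixes M V A :: "real mat" and k m :: nat
  assumes "k \<le> m"
    and "M \<in> carrier_mat m m" and "diagonal_mat M"
    and "\<And>i. i < m \<Longrightarrow> M $$ (i, i) > 0"
    and "V \<in> carrier_mat m k" and "V\<^sup>T * M * V = 1\<^sub>m k"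
    and "A \<in> carrier_mat m m" and "A\<^sup>T = A"
  shows "\<forall>i. 1 \<le> i \<and> i \<le> k \<longrightarrow>
    ith_eigenvalue (the (mat_inverse M) * A) i \<le> ith_eigenvalue (V\<^sup>T * A * V) i \<and>
    ith_eigenvalue (V\<^sup>T * A * V) i \<le> ith_eigenvalue (the (mat_inverse M) * A) (m - k + i)"
proof -
  define R where "R = mat_diag m (\<lambda>i. sqrt (M $$ (i, i)))"
  define S where "S = mat_diag m (\<lambda>i. inverse (sqrt (M $$ (i, i))))"
  have R: "R \<in> carrier_mat m m" and S: "S \<in> carrier_mat m m" by (simp_all add: R_def S_def)
  have RT: "R\<^sup>T = R" and ST: "S\<^sup>T = S" by (auto simp: R_def S_def mat_diag_def intro!: eq_matI)
  have RR: "R * R = M"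
    unfolding R_def mat_diag_diag
    by (rule eq_matI) (use assms(2-4) in \<open>auto simp: mat_diag_def diagonal_mat_def less_imp_le\<close>)
  have cong: "mat_diag m f = mat_diag m g" if "\<And>i. i < m \<Longrightarrow> f i = g i" for f g :: "nat \<Rightarrow> real"
    using that by (auto simp: mat_diag_def intro!: eq_matI)
  have "sqrt (M $$ (i, i)) \<noteq> 0" if "i < m" for i using assms(4)[OF that] by simp
  then have "R * S = mat_diag m (\<lambda>_. 1)" "S * R = mat_diag m (\<lambda>_. 1)"
    unfolding R_def S_def mat_diag_diag by (intro cong; simp)+
  then have RS: "R * S = 1\<^sub>m m" and SR: "S * R = 1\<^sub>m m" by simp_all
  have M_inv: "the (mat_inverse M) = S * S"
  proof -
    have "the (mat_inverse M) = mat_diag m (\<lambda>i. inverse (M $$ (i, i)))"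
      using mat_inverse_diagonal[OF assms(2,3)] assms(4)
      by (auto simp: mat_diag_def less_imp_neq[symmetric] intro!: cong_mat)
    also have "\<dots> = S * S" unfolding S_def mat_diag_diag
      by (rule cong) (use assms(4) in \<open>auto simp: less_imp_le simp flip: inverse_mult_distrib\<close>)
    finally show ?thesis .
  qed
  define B where "B = S * A * S"
  note carr = assms(5,7) R S
  have B: "B \<in> carrier_mat m m" using carr by (simp add: B_def)
  note assoc = assoc_mult_mat[of _ m m _ m _ m]
  have SRX: "S * (R * X) = X" and RSX: "R * (S * X) = X" if "X \<in> carrier_mat m n" for X n
    using assoc_mult_mat[OF S R that] assoc_mult_mat[OF R S that] that RS SR by simp_all
  have BT: "B\<^sup>T = B"
    using assms(8) ST carr by (simp add: B_def transpose_mult[of _ m m _ m] assoc)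
  \<comment> \<open>Since \<open>S\<close> and \<open>R\<close> are mutually inverse,
    \<open>S * S * A = S * (S * A * S) * R\<close>; equal characteristic polynomials then give equal
    eigenvalue lists.\<close>
  have "similar_mat (the (mat_inverse M) * A) B"
    by (rule similar_matI[of _ _ S R m]) (use RS SR carr B SRX[of _ m] RSX[of _ m] in \<open>simp_all add: M_inv B_def assoc\<close>)
  then have ev: "eigenvalue_list (the (mat_inverse M) * A) = eigenvalue_list B"
    unfolding eigenvalue_list_def by (simp add: char_poly_similar)
  define U where "U = R * V"
  have U: "U \<in> carrier_mat m k" using carr by (simp add: U_def)
  have UT: "U\<^sup>T = V\<^sup>T * R" using carr by (simp add: U_def transpose_mult[of _ m m _ k] RT)
  note assoc' = assoc_mult_mat[of _ m m _ m _ k] assoc_mult_mat[of _ k m _ m _ k] assoc_mult_mat[of _ k m _ m _ m]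
  have "U\<^sup>T * U = V\<^sup>T * M * V"
    unfolding UT RR[symmetric] using carr by (simp add: U_def assoc assoc')
  then have UU: "U\<^sup>T * U = 1\<^sub>m k" using assms(6) by simp
  \<comment> \<open>The factors \<open>R\<close> contributed by \<open>U\<close> cancel against the
    factors \<open>S\<close> in \<open>B\<close>.\<close>
  have UBU: "U\<^sup>T * B * U = V\<^sup>T * A * V"
    unfolding UT using carr by (simp add: U_def B_def assoc assoc' SRX[of _ k] RSX[of _ k])
  show ?thesis
  proof (intro allI impI)
    fix i assume i: "1 \<le> i \<and> i \<le> k"
    \<comment> \<open>Passage from 1-based eigenvalue numbers to 0-based list positions;
      \<open>1 \<le> i\<close> keeps the truncated subtraction exact.\<close>
    then have "i - 1 < k" "m - k + i - 1 = m - k + (i - 1)" by auto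
    with eigenvalue_list_interlacing[OF B BT U UU assms(1), of "i - 1"]
    show "ith_eigenvalue (the (mat_inverse M) * A) i \<le> ith_eigenvalue (V\<^sup>T * A * V) i \<and>
      ith_eigenvalue (V\<^sup>T * A * V) i \<le> ith_eigenvalue (the (mat_inverse M) * A) (m - k + i)"
      by (simp add: ith_eigenvalue_def ev UBU)
  qed
qed

end
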